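(* Let $\mathbb{F}\in\{\mathbb{R},\mathbb{C}\}$, with $\beta=1$ if $\mathbb{F}=\mathbb{R}$ and $\beta=2$ if $\mathbb{F}=\mathbb{C}$. Let $A,\hat A_{\rm out}\in\mathbb{F}^{m\times n}$ be matrices that do not depend on $\Theta$, where $\Theta\in\mathbb{F}^{q\times m}$ ($q\ge1$) is a standard normal matrix. Define the error estimator $$\mathrm{err}_2^2(\hat A_{\rm out})=\frac{1}{\beta q}\,\|\Theta(A-\hat A_{\rm out})\|_2^2.$$ Then, with respect to the randomness in $\Theta$, $$\mathbb{E}\big[\mathrm{err}_2^2(\hat A_{\rm out})\big]=\|A-\hat A_{\rm out}\|_2^2,\qquad \operatorname{Var}\big[\mathrm{err}_2^2(\hat A_{\rm out})\big]=\frac{2}{\beta q}\,\|A-\hat A_{\rm out}\|_4^4.$$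
   Context: $\|\cdot\|_p$ is the Schatten $p$-norm, i.e. the $\ell_p$ norm of the vector of singular values; $\|\cdot\|_2$ is the Frobenius norm. A standard normal matrix over $\mathbb{R}$ has independent $N(0,1)$ entries; over $\mathbb{C}$ its entries are independent and of the form $g_1+\mathrm{i}g_2$ with $g_1,g_2$ independent real $N(0,1)$ variables. "Does not depend on $\Theta$" means $A$ and $\hat A_{\rm out}$ are treated as fixed matrices. *)

theory Defs
  imports
    "HOL-Probability.Probability"
    "HOL-Computational_Algebra.Polynomial"
    "Jordan_Normal_Form.Char_Poly"
    "Jordan_Normal_Form.Schur_Decomposition"
begin

text \<open>
  The eigenvalues of \<open>A\<^sup>* A\<close>, counted with multiplicity, are the roots of its characteristic
  polynomial. They are nonnegative reals, so for both ground fields \<open>norm\<close> merely reads them as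
  elements of type \<^typ>\<open>real\<close>. An \<open>m \<times> n\<close> matrix gets \<open>n\<close> singular values; compared with the
  convention of \<open>min m n\<close> singular values this can only add zeros, which do not
  affect the \<open>\<ell>\<^sub>p\<close> norm.
\<close>

definition singular_values :: "'a :: {conjugatable_field, real_normed_field} mat \<Rightarrow> real multiset"
  where "singular_values A =
    image_mset (\<lambda>ev. sqrt (norm ev)) (proots (char_poly (mat_adjoint A * A)))"

text \<open>Meant for \<open>0 < p < \<infinity>\<close>; note \<open>0 powr p = 0\<close>.\<close>

definition schatten_norm :: "real \<Rightarrow> 'a :: {conjugatable_field, real_normed_field} mat \<Rightarrow> real"
  where "schatten_norm p A = (\<Sum>s\<in>#singular_values A. s powr p) powr (1 / p)"

context prob_space
begin

definition std_normal :: "('a \<Rightarrow> real) \<Rightarrow> bool"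
  where "std_normal X \<longleftrightarrow> distributed M lborel X std_normal_density"

definition std_normal_complex :: "('a \<Rightarrow> complex) \<Rightarrow> bool"
  where "std_normal_complex Z \<longleftrightarrow>
    std_normal (\<lambda>\<omega>. Re (Z \<omega>)) \<and> std_normal (\<lambda>\<omega>. Im (Z \<omega>)) \<and>
    indep_var borel (\<lambda>\<omega>. Re (Z \<omega>)) borel (\<lambda>\<omega>. Im (Z \<omega>))"

definition std_normal_mat :: "nat \<Rightarrow> nat \<Rightarrow> ('a \<Rightarrow> real mat) \<Rightarrow> bool"
  where "std_normal_mat q m \<Theta> \<longleftrightarrow>
    (\<forall>\<omega>\<in>space M. \<Theta> \<omega> \<in> carrier_mat q m) \<and>
    indep_vars (\<lambda>_. borel) (\<lambda>(i, j) \<omega>. \<Theta> \<omega> $$ (i, j)) ({..<q} \<times> {..<m}) \<and>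
    (\<forall>i<q. \<forall>j<m. std_normal (\<lambda>\<omega>. \<Theta> \<omega> $$ (i, j)))"

text \<open>The entries have variance 2, i.e. they are not rescaled by \<open>1 / sqrt 2\<close>.\<close>

definition std_normal_mat_complex :: "nat \<Rightarrow> nat \<Rightarrow> ('a \<Rightarrow> complex mat) \<Rightarrow> bool"
  where "std_normal_mat_complex q m \<Theta> \<longleftrightarrow>
    (\<forall>\<omega>\<in>space M. \<Theta> \<omega> \<in> carrier_mat q m) \<and>
    indep_vars (\<lambda>_. borel) (\<lambda>(i, j) \<omega>. \<Theta> \<omega> $$ (i, j)) ({..<q} \<times> {..<m}) \<and>
    (\<forall>i<q. \<forall>j<m. std_normal_complex (\<lambda>\<omega>. \<Theta> \<omega> $$ (i, j)))"

text \<open>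
  The Bochner integral of a non-integrable function is \<open>0\<close>, so equations about \<open>expectation\<close> and
  \<open>variance\<close> only carry their usual meaning together with the existence of the moments.
\<close>

definition has_mean_variance :: "('a \<Rightarrow> real) \<Rightarrow> real \<Rightarrow> real \<Rightarrow> bool"
  where "has_mean_variance X \<mu> v \<longleftrightarrow>
    integrable M X \<and> integrable M (\<lambda>\<omega>. (X \<omega>)\<^sup>2) \<and> expectation X = \<mu> \<and> variance X = v"

end

text \<open>The squared estimator \<open>err\<^sub>2\<^sup>2\<close>; \<open>\<beta>\<close> is the real dimension of the ground field.\<close>

definition err_sq ::
  "nat \<Rightarrow> nat \<Rightarrow> 'a :: {conjugatable_field, real_normed_field} mat \<Rightarrow> 'a mat \<Rightarrow> 'a mat \<Rightarrow> real"
  where "err_sq \<beta> q \<Theta> A B = 1 / (real \<beta> * real q) * (schatten_norm 2 (\<Theta> * (A - B)))\<^sup>2"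

end

theory Submission
  imports Defs
begin

text \<open>
  With \<open>B = A - A\<^sub>o\<^sub>u\<^sub>t\<close> and \<open>H = B B\<^sup>*\<close>, the squared Frobenius norm of \<open>\<Theta> B\<close> is a sum over the rows
  \<open>\<theta>\<close> of \<open>\<Theta>\<close> of the forms \<open>\<theta> H \<theta>\<^sup>*\<close>, hence a block-diagonal real quadratic form in independent
  standard normal variables (the real and imaginary parts of the entries in the complex case). By
  Isserlis' theorem a form \<open>g\<^sup>T S g\<close> with \<open>S\<close> symmetric has mean \<open>tr S\<close> and variance \<open>2 tr S\<^sup>2\<close>. On
  the other side, Schur triangularisation of \<open>B\<^sup>* B\<close> identifies \<open>\<bar>B\<bar>\<^sub>2\<^sup>2\<close> with \<open>tr H\<close> and \<open>\<bar>B\<bar>\<^sub>4\<^sup>4\<close>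
  with \<open>tr H\<^sup>2\<close>.
\<close>

section \<open>Moments of Gaussian quadratic forms\<close>

definition std_normal_moment :: "nat \<Rightarrow> real"
  where "std_normal_moment k = (\<integral>x. std_normal_density x * x ^ k \<partial>lborel)"

text \<open>Squaring a quadratic form produces monomials of total degree four, so exponents up to 4
  are all that occur below.\<close>

lemma std_normal_moment_simps [simp]:
  "std_normal_moment 0 = 1" "std_normal_moment (Suc 0) = 0" "std_normal_moment 2 = 1"
  "std_normal_moment 3 = 0" "std_normal_moment 4 = 3"
  using integral_std_normal_moment_even[of 0] integral_std_normal_moment_odd[of 0]
    integral_std_normal_moment_even[of 1] integral_std_normal_moment_odd[of 1]
    integral_std_normal_moment_even[of 2]
  by (simp_all add: std_normal_moment_def fact_numeral eval_nat_numeral)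

context prob_space
begin

lemma std_normal_power:
  assumes "std_normal X"
  shows "integrable M (\<lambda>\<omega>. X \<omega> ^ k)" and "expectation (\<lambda>\<omega>. X \<omega> ^ k) = std_normal_moment k"
proof -
  have D: "distributed M lborel X std_normal_density"
    using assms by (simp add: std_normal_def)
  show "integrable M (\<lambda>\<omega>. X \<omega> ^ k)"
    using distributed_integrable[OF D, of "\<lambda>x. x ^ k"] integrable_std_normal_moment[of k] by simp
  show "expectation (\<lambda>\<omega>. X \<omega> ^ k) = std_normal_moment k"
    using distributed_integral[OF D, of "\<lambda>x. x ^ k"] by (simp add: std_normal_moment_def)
qed

text \<open>
  This consequence of joint independence is all that the moments of a quadratic form depend on.
  For a complex matrix it follows directly from the two-level independence hypothesis.
\<close>

definition std_normal_moments_on :: "'i set \<Rightarrow> ('i \<Rightarrow> 'a \<Rightarrow> real) \<Rightarrow> bool"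
  where "std_normal_moments_on I g \<longleftrightarrow>
    (\<forall>e. has_bochner_integral M (\<lambda>\<omega>. \<Prod>x\<in>I. g x \<omega> ^ e x) (\<Prod>x\<in>I. std_normal_moment (e x)))"

text \<open>Indicator exponents present one variable as a monomial over the whole of
  \<open>I\<close>. Adding such exponents then encodes a product of variables whose indices may
  coincide.\<close>

lemma prod_power_indicator:
  fixes f :: "'i \<Rightarrow> real"
  assumes "finite I" "i \<in> I"
  shows "(\<Prod>x\<in>I. f x ^ (if x = i then 1 else 0)) = f i"
  using assms by (subst prod.remove[of I i]) (auto intro!: prod.neutral)

lemma has_bochner_integral_pair:
  assumes "finite I" and g: "std_normal_moments_on I g" and ij: "i \<in> I" "j \<in> I"
  shows "has_bochner_integral M (\<lambda>\<omega>. g i \<omega> * g j \<omega>) (of_bool (i = j))"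
proof -
  let ?d = "\<lambda>i x. if x = i then 1 else 0 :: nat"
  have 1: "(\<Prod>x\<in>I. g x \<omega> ^ (?d i x + ?d j x)) = g i \<omega> * g j \<omega>" for \<omega>
    using prod_power_indicator[OF \<open>finite I\<close>, of _ "\<lambda>x. g x \<omega>"] ij
    by (simp only: power_add prod.distrib)
  \<comment> \<open>Indices outside \<open>{i, j}\<close> have exponent 0 and contribute the zeroth
    moment 1.\<close>
  have "(\<Prod>x\<in>I. std_normal_moment (?d i x + ?d j x)) =
      (\<Prod>x\<in>{i, j}. std_normal_moment (?d i x + ?d j x))"
    using assms by (intro prod.mono_neutral_right) auto
  also have "\<dots> = of_bool (i = j)"
    by (cases "i = j") (auto simp: numeral_2_eq_2[symmetric])
  finally have 2: "(\<Prod>x\<in>I. std_normal_moment (?d i x + ?d j x)) = of_bool (i = j)" .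
  from g[unfolded std_normal_moments_on_def, rule_format, of "\<lambda>x. ?d i x + ?d j x"]
  show ?thesis by (simp only: 1 2)
qed

text \<open>Isserlis' theorem in degree four, decided by which indices coincide. An index of odd
  multiplicity contributes a vanishing odd moment; two distinct pairs give 1, for the one pairing
  that survives; four equal indices give the fourth moment 3, the number of pairings.\<close>

lemma has_bochner_integral_isserlis:
  assumes "finite I" and g: "std_normal_moments_on I g"
    and ijkl: "i \<in> I" "j \<in> I" "k \<in> I" "l \<in> I"
  shows "has_bochner_integral M (\<lambda>\<omega>. g i \<omega> * g j \<omega> * g k \<omega> * g l \<omega>)
    (of_bool (i = j) * of_bool (k = l) + of_bool (i = k) * of_bool (j = l)
      + of_bool (i = l) * of_bool (j = k))"
    (is "has_bochner_integral M _ ?rhs")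
proof -
  let ?d = "\<lambda>i x. if x = i then 1 else 0 :: nat"
  let ?e = "\<lambda>x. ?d i x + ?d j x + ?d k x + ?d l x"
  have 1: "(\<Prod>x\<in>I. g x \<omega> ^ ?e x) = g i \<omega> * g j \<omega> * g k \<omega> * g l \<omega>" for \<omega>
    using prod_power_indicator[OF \<open>finite I\<close>, of _ "\<lambda>x. g x \<omega>"] ijkl
    by (simp only: power_add prod.distrib)
  have "(\<Prod>x\<in>I. std_normal_moment (?e x)) = (\<Prod>x\<in>{i, j, k, l}. std_normal_moment (?e x))"
    using assms by (intro prod.mono_neutral_right) auto
  also have "\<dots> = ?rhs"
    by (cases "i = j"; cases "i = k"; cases "i = l"; cases "j = k"; cases "j = l"; cases "k = l")
      (auto simp: numeral_2_eq_2[symmetric] numeral_3_eq_3[symmetric] insert_commute)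
  finally have 2: "(\<Prod>x\<in>I. std_normal_moment (?e x)) = ?rhs" .
  from g[unfolded std_normal_moments_on_def, rule_format, of ?e]
  show ?thesis by (simp only: 1 2)
qed

text \<open>In the second moment the pairing of \<open>i\<close> with \<open>j\<close> and
  \<open>k\<close> with \<open>l\<close> reproduces the squared mean. The two crossed pairings give
  the sums of \<open>S i j * S i j\<close> and \<open>S i j * S j i\<close>, which agree by symmetry
  and make up the variance.\<close>

lemma quadratic_form_has_mean_variance:
  assumes "finite I" and g: "std_normal_moments_on I g"
    and sym: "\<And>x y. x \<in> I \<Longrightarrow> y \<in> I \<Longrightarrow> S x y = S y x"
  shows "has_mean_variance (\<lambda>\<omega>. \<Sum>x\<in>I. \<Sum>y\<in>I. S x y * (g x \<omega> * g y \<omega>))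
    (\<Sum>x\<in>I. S x x) (2 * (\<Sum>x\<in>I. \<Sum>y\<in>I. (S x y)\<^sup>2))"
    (is "has_mean_variance ?Y ?\<mu> ?v")
proof -
  have "has_bochner_integral M ?Y (\<Sum>x\<in>I. \<Sum>y\<in>I. S x y * of_bool (x = y))"
    using assms by (intro has_bochner_integral_sum has_bochner_integral_mult_right
        has_bochner_integral_pair) auto
  also have "(\<Sum>x\<in>I. \<Sum>y\<in>I. S x y * of_bool (x = y)) = ?\<mu>"
    using \<open>finite I\<close> by (intro sum.cong) (auto simp: of_bool_def if_distrib cong: if_cong)
  finally have Y: "has_bochner_integral M ?Y ?\<mu>" .
  let ?E = "\<lambda>i j k l. of_bool (i = j) * of_bool (k = l) + of_bool (i = k) * of_bool (j = l)
      + of_bool (i = l) * of_bool (j = k) :: real"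
  have sq: "(?Y \<omega>)\<^sup>2 = (\<Sum>i\<in>I. \<Sum>j\<in>I. \<Sum>k\<in>I. \<Sum>l\<in>I.
      S i j * S k l * (g i \<omega> * g j \<omega> * g k \<omega> * g l \<omega>))" for \<omega>
    unfolding power2_eq_square sum_distrib_right sum_distrib_left by (simp add: mult_ac)
  have "has_bochner_integral M (\<lambda>\<omega>. (?Y \<omega>)\<^sup>2)
      (\<Sum>i\<in>I. \<Sum>j\<in>I. \<Sum>k\<in>I. \<Sum>l\<in>I. S i j * S k l * ?E i j k l)"
    unfolding sq using assms by (intro has_bochner_integral_sum has_bochner_integral_mult_right
        has_bochner_integral_isserlis) auto
  also have "(\<Sum>i\<in>I. \<Sum>j\<in>I. \<Sum>k\<in>I. \<Sum>l\<in>I. S i j * S k l * ?E i j k l) = ?\<mu>\<^sup>2 + ?v"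
  proof -
    \<comment> \<open>Once Kronecker deltas are conditionals, and conditions free of the summation
      index are pulled out of the sums, the sums over \<open>k\<close> and \<open>l\<close>
      collapse.\<close>
    have delta: "of_bool P * x = (if P then x else 0)" "x * of_bool P = (if P then x else 0)"
      "x * (if P then y else 0) = (if P then x * y else 0)"
      "(\<Sum>z\<in>I. if P then f z else 0) = (if P then sum f I else 0)"
      for P and x y :: real and f :: "'b \<Rightarrow> real"
      by simp_all
    have "(\<Sum>k\<in>I. \<Sum>l\<in>I. S i j * S k l * ?E i j k l) =
        of_bool (i = j) * S i j * ?\<mu> + S i j * S i j + S i j * S j i"
      if "i \<in> I" "j \<in> I" for i j
      using \<open>finite I\<close> that
      by (simp add: delta sum.distrib distrib_left sum_distrib_left)
    then have "(\<Sum>i\<in>I. \<Sum>j\<in>I. \<Sum>k\<in>I. \<Sum>l\<in>I. S i j * S k l * ?E i j k l) =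
       (\<Sum>i\<in>I. \<Sum>j\<in>I. of_bool (i = j) * S i j * ?\<mu> + 2 * (S i j)\<^sup>2)"
      using sym by (intro sum.cong refl) (simp add: power2_eq_square)
    also have "\<dots> = ?\<mu>\<^sup>2 + ?v"
      using \<open>finite I\<close>
      by (simp add: sum.distrib sum_distrib_left[symmetric] sum_distrib_right[symmetric]
          power2_eq_square of_bool_def if_distrib[of "\<lambda>x. x * _"] cong: if_cong)
    finally show ?thesis .
  qed
  finally have Y2: "has_bochner_integral M (\<lambda>\<omega>. (?Y \<omega>)\<^sup>2) (?\<mu>\<^sup>2 + ?v)" .
  have "variance ?Y = ?v"
    using variance_eq[OF integrable.intros[OF Y] integrable.intros[OF Y2]]
      has_bochner_integral_integral_eq[OF Y] has_bochner_integral_integral_eq[OF Y2] by simp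
  then show ?thesis
    unfolding has_mean_variance_def
    using integrable.intros[OF Y] integrable.intros[OF Y2] has_bochner_integral_integral_eq[OF Y]
    by blast
qed

text \<open>All rows share the form \<open>T\<close>, so the full matrix is block diagonal with
  \<open>q\<close> copies of \<open>c * T\<close>. Its trace picks up the factor
  \<open>c * q\<close>, its squared Frobenius norm \<open>c\<^sup>2 * q\<close>.\<close>

lemma block_quadratic_form_has_mean_variance:
  fixes T :: "'j \<Rightarrow> 'j \<Rightarrow> real" and q :: nat
  assumes "finite J" and g: "std_normal_moments_on ({..<q} \<times> J) g"
    and sym: "\<And>a b. a \<in> J \<Longrightarrow> b \<in> J \<Longrightarrow> T a b = T b a"
  shows "has_mean_variance
    (\<lambda>\<omega>. c * (\<Sum>i<q. \<Sum>a\<in>J. \<Sum>b\<in>J. T a b * (g (i, a) \<omega> * g (i, b) \<omega>)))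
    (c * real q * (\<Sum>a\<in>J. T a a)) (2 * c\<^sup>2 * real q * (\<Sum>a\<in>J. \<Sum>b\<in>J. (T a b)\<^sup>2))"
proof -
  define S where "S x y = of_bool (fst x = fst y) * (c * T (snd x) (snd y))"
    for x y :: "nat \<times> 'j"
  let ?I = "{..<q} \<times> J"
  have block: "(\<Sum>x\<in>?I. \<Sum>y\<in>?I. of_bool (fst x = fst y) * f (fst x) (snd x) (snd y)) =
      (\<Sum>i<q. \<Sum>a\<in>J. \<Sum>b\<in>J. f i a b)" for f :: "nat \<Rightarrow> 'j \<Rightarrow> 'j \<Rightarrow> real"
  proof -
    have "(\<Sum>b\<in>J. of_bool P * h b) = (if P then sum h J else 0)" for P and h :: "'j \<Rightarrow> real"
      by simp
    then show ?thesis
      unfolding sum.cartesian_product' fst_conv snd_conv by simp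
  qed
  have "has_mean_variance (\<lambda>\<omega>. \<Sum>x\<in>?I. \<Sum>y\<in>?I. S x y * (g x \<omega> * g y \<omega>))
    (\<Sum>x\<in>?I. S x x) (2 * (\<Sum>x\<in>?I. \<Sum>y\<in>?I. (S x y)\<^sup>2))"
    using assms(1) g sym by (intro quadratic_form_has_mean_variance) (auto simp: S_def)
  also have "(\<lambda>\<omega>. \<Sum>x\<in>?I. \<Sum>y\<in>?I. S x y * (g x \<omega> * g y \<omega>)) =
      (\<lambda>\<omega>. c * (\<Sum>i<q. \<Sum>a\<in>J. \<Sum>b\<in>J. T a b * (g (i, a) \<omega> * g (i, b) \<omega>)))"
  proof
    fix \<omega>
    have "(\<Sum>x\<in>?I. \<Sum>y\<in>?I. S x y * (g x \<omega> * g y \<omega>)) =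
      (\<Sum>x\<in>?I. \<Sum>y\<in>?I. of_bool (fst x = fst y) *
         (c * (T (snd x) (snd y) * (g (fst x, snd x) \<omega> * g (fst x, snd y) \<omega>))))"
      by (intro sum.cong refl) (auto simp: S_def)
    then show "(\<Sum>x\<in>?I. \<Sum>y\<in>?I. S x y * (g x \<omega> * g y \<omega>)) =
       c * (\<Sum>i<q. \<Sum>a\<in>J. \<Sum>b\<in>J. T a b * (g (i, a) \<omega> * g (i, b) \<omega>))"
      using block[of "\<lambda>i a b. c * (T a b * (g (i, a) \<omega> * g (i, b) \<omega>))"]
      by (simp add: sum_distrib_left)
  qed
  also have "(\<Sum>x\<in>?I. S x x) = c * real q * (\<Sum>a\<in>J. T a a)"
    by (simp add: S_def sum.cartesian_product' sum_distrib_left mult_ac)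
  also have "2 * (\<Sum>x\<in>?I. \<Sum>y\<in>?I. (S x y)\<^sup>2) = 2 * c\<^sup>2 * real q * (\<Sum>a\<in>J. \<Sum>b\<in>J. (T a b)\<^sup>2)"
    using block[of "\<lambda>i a b. c\<^sup>2 * (T a b)\<^sup>2"]
    by (simp add: S_def power_mult_distrib sum_distrib_left[symmetric] mult_ac of_bool_def
        if_distrib[of "\<lambda>x. x ^ 2"] cong: if_cong)
  finally show ?thesis .
qed

text \<open>The dimensions of \<open>\<Theta> \<omega>\<close> are known only on the sample space,
  so the estimator can be exchanged for a quadratic form only there.\<close>

lemma has_mean_variance_cong:
  assumes "\<And>\<omega>. \<omega> \<in> space M \<Longrightarrow> X \<omega> = Y \<omega>"
  shows "has_mean_variance X \<mu> v \<longleftrightarrow> has_mean_variance Y \<mu> v"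
proof -
  have "integrable M X = integrable M Y"
    "integrable M (\<lambda>\<omega>. (X \<omega>)\<^sup>2) = integrable M (\<lambda>\<omega>. (Y \<omega>)\<^sup>2)"
    using assms by (intro Bochner_Integration.integrable_cong; simp)+
  moreover have "expectation X = expectation Y"
    "expectation (\<lambda>\<omega>. (X \<omega> - expectation X)\<^sup>2) = expectation (\<lambda>\<omega>. (Y \<omega> - expectation X)\<^sup>2)"
    using assms by (auto intro!: Bochner_Integration.integral_cong)
  ultimately show ?thesis
    by (simp add: has_mean_variance_def)
qed

section \<open>Joint moments of the entries of a Gaussian matrix\<close>

lemma std_normal_mat_moments:
  assumes "std_normal_mat q m \<Theta>"
  shows "std_normal_moments_on ({..<q} \<times> {..<m}) (\<lambda>(i, j) \<omega>. \<Theta> \<omega> $$ (i, j))"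
proof -
  let ?I = "{..<q} \<times> {..<m}"
  let ?g = "\<lambda>(i, j) \<omega>. \<Theta> \<omega> $$ (i, j)"
  have ind: "indep_vars (\<lambda>_. borel) ?g ?I"
    and N: "\<And>x. x \<in> ?I \<Longrightarrow> std_normal (?g x)"
    using assms by (auto simp: std_normal_mat_def)
  show ?thesis
    unfolding std_normal_moments_on_def
  proof
    fix e
    \<comment> \<open>Powers of independent entries remain independent, so the expectation of a
      monomial factors over the entries.\<close>
    have i: "indep_vars (\<lambda>_. borel) (\<lambda>x \<omega>. ?g x \<omega> ^ e x) ?I"
      by (rule indep_vars_compose2[OF ind]) simp
    have "has_bochner_integral M (\<lambda>\<omega>. \<Prod>x\<in>?I. ?g x \<omega> ^ e x)
       (\<Prod>x\<in>?I. expectation (\<lambda>\<omega>. ?g x \<omega> ^ e x))"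
      using indep_vars_integrable[OF _ i] indep_vars_lebesgue_integral[OF _ i] std_normal_power(1)[OF N]
      by (simp add: has_bochner_integral_iff)
    then show "has_bochner_integral M (\<lambda>\<omega>. \<Prod>x\<in>?I. ?g x \<omega> ^ e x) (\<Prod>x\<in>?I. std_normal_moment (e x))"
      using std_normal_power(2)[OF N] by simp
  qed
qed

text \<open>The expectation factors twice: first over the entries, by their joint independence, then
  within each entry over its real and imaginary part. Joint independence of all real coordinates is
  never established as such.\<close>

lemma std_normal_mat_complex_moments:
  assumes "std_normal_mat_complex q m \<Theta>"
  shows "std_normal_moments_on ({..<q} \<times> {..<m} \<times> UNIV)
    (\<lambda>(i, j, c) \<omega>. (if c then Im else Re) (\<Theta> \<omega> $$ (i, j)))"
proof -
  let ?I = "{..<q} \<times> {..<m}"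
  let ?Z = "\<lambda>(i, j) \<omega>. \<Theta> \<omega> $$ (i, j)"
  let ?g = "\<lambda>(i, j, c) \<omega>. (if c then Im else Re) (\<Theta> \<omega> $$ (i, j))"
  have ind: "indep_vars (\<lambda>_. borel) ?Z ?I"
    and N: "\<And>x. x \<in> ?I \<Longrightarrow> std_normal_complex (?Z x)"
    using assms by (auto simp: std_normal_mat_complex_def)
  show ?thesis
    unfolding std_normal_moments_on_def
  proof
    fix e :: "nat \<times> nat \<times> bool \<Rightarrow> nat"
    define a b where "a = (\<lambda>(i, j). e (i, j, False))" and "b = (\<lambda>(i, j). e (i, j, True))"
    let ?W = "\<lambda>x \<omega>. Re (?Z x \<omega>) ^ a x * Im (?Z x \<omega>) ^ b x"
    have split: "(\<Prod>x\<in>{..<q} \<times> {..<m} \<times> UNIV. f x) = (\<Prod>(i, j)\<in>?I. f (i, j, False) * f (i, j, True))"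
      for f :: "nat \<times> nat \<times> bool \<Rightarrow> real"
      by (simp add: prod.cartesian_product' UNIV_bool prod.distrib mult_ac)
    have W: "integrable M (?W x)"
        "expectation (?W x) = std_normal_moment (a x) * std_normal_moment (b x)"
      if "x \<in> ?I" for x
    proof -
      have R: "std_normal (\<lambda>\<omega>. Re (?Z x \<omega>))" and J: "std_normal (\<lambda>\<omega>. Im (?Z x \<omega>))"
        and RJ: "indep_var borel (\<lambda>\<omega>. Re (?Z x \<omega>)) borel (\<lambda>\<omega>. Im (?Z x \<omega>))"
        using N[OF that] by (auto simp: std_normal_complex_def)
      have "indep_var borel ((\<lambda>t. t ^ a x) \<circ> (\<lambda>\<omega>. Re (?Z x \<omega>)))
          borel ((\<lambda>t. t ^ b x) \<circ> (\<lambda>\<omega>. Im (?Z x \<omega>)))"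
        by (rule indep_var_compose[OF RJ]) simp_all
      then have i: "indep_var borel (\<lambda>\<omega>. Re (?Z x \<omega>) ^ a x) borel (\<lambda>\<omega>. Im (?Z x \<omega>) ^ b x)"
        by (simp add: comp_def)
      show "integrable M (?W x)"
        using indep_var_integrable[OF i] std_normal_power(1)[OF R] std_normal_power(1)[OF J] by simp
      show "expectation (?W x) = std_normal_moment (a x) * std_normal_moment (b x)"
        using indep_var_lebesgue_integral[OF i] std_normal_power[OF R] std_normal_power[OF J] by simp
    qed
    \<comment> \<open>Each \<open>?W x\<close> is a measurable function of the single entry
      \<open>?Z x\<close> and so inherits independence across entries.\<close>
    have i: "indep_vars (\<lambda>_. borel) ?W ?I"
      by (rule indep_vars_compose2[OF ind, where Y = "\<lambda>x z. Re z ^ a x * Im z ^ b x"]) simp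
    have "has_bochner_integral M (\<lambda>\<omega>. \<Prod>x\<in>?I. ?W x \<omega>) (\<Prod>x\<in>?I. expectation (?W x))"
      using indep_vars_integrable[OF _ i] indep_vars_lebesgue_integral[OF _ i] W(1)
      by (simp add: has_bochner_integral_iff)
    also have "(\<Prod>x\<in>?I. expectation (?W x)) = (\<Prod>x\<in>?I. std_normal_moment (a x) * std_normal_moment (b x))"
      using W(2) by (intro prod.cong) auto
    finally show "has_bochner_integral M (\<lambda>\<omega>. \<Prod>x\<in>{..<q} \<times> {..<m} \<times> UNIV. ?g x \<omega> ^ e x)
        (\<Prod>x\<in>{..<q} \<times> {..<m} \<times> UNIV. std_normal_moment (e x))"
      by (simp add: split a_def b_def case_prod_unfold)
  qed
qed

end

section \<open>Schatten norms and traces\<close>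

definition mat_trace :: "'a::comm_monoid_add mat \<Rightarrow> 'a"
  where "mat_trace A = (\<Sum>i<dim_row A. A $$ (i, i))"

lemma mat_trace_mult_comm:
  fixes A B :: "'a::comm_semiring_0 mat"
  assumes "A \<in> carrier_mat n k" "B \<in> carrier_mat k n"
  shows "mat_trace (A * B) = mat_trace (B * A)"
proof -
  have "mat_trace (A * B) = (\<Sum>i<n. \<Sum>j<k. A $$ (i, j) * B $$ (j, i))"
    using assms by (simp add: mat_trace_def scalar_prod_def atLeast0LessThan)
  also have "\<dots> = (\<Sum>j<k. \<Sum>i<n. B $$ (j, i) * A $$ (i, j))"
    by (subst sum.swap) (simp add: mult.commute)
  also have "\<dots> = mat_trace (B * A)"
    using assms by (simp add: mat_trace_def scalar_prod_def atLeast0LessThan)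
  finally show ?thesis .
qed

lemma mat_trace_similar:
  fixes A B :: "'a::comm_ring_1 mat"
  assumes "similar_mat A B"
  shows "mat_trace A = mat_trace B"
proof -
  obtain n P Q where c: "{A, B, P, Q} \<subseteq> carrier_mat n n" and QP: "Q * P = 1\<^sub>m n"
    and A: "A = P * B * Q"
    using similar_matD[OF assms] by blast
  have "mat_trace A = mat_trace (Q * (P * B))"
    unfolding A using c by (intro mat_trace_mult_comm[of _ n n]) auto
  also have "Q * (P * B) = B"
    using c QP by (subst assoc_mult_mat[symmetric, of _ n n _ n _ n]) auto
  finally show ?thesis .
qed

text \<open>Schur decomposition makes \<open>G\<close> similar to an upper triangular
  \<open>T\<close> with diagonal \<open>es\<close>, and \<open>G * G\<close> similar to
  \<open>T * T\<close>. Traces are invariant under similarity.\<close>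

lemma trace_eq_sum_eigenvalues:
  fixes G :: "'a::conjugatable_ordered_field mat"
  assumes G: "G \<in> carrier_mat n n" and cp: "char_poly G = (\<Prod>a\<leftarrow>es. [:- a, 1:])"
  shows "mat_trace G = sum_list es" and "mat_trace (G * G) = (\<Sum>a\<leftarrow>es. a\<^sup>2)"
proof -
  obtain T P Q where s: "schur_decomposition G es = (T, P, Q)"
    by (metis prod_cases3)
  from schur_decomposition[OF G cp s]
  have w: "similar_mat_wit G T P Q" and ut: "upper_triangular T" and d: "diag_mat T = es"
    by auto
  have T: "T \<in> carrier_mat n n" using similar_mat_witD2[OF G w] by auto
  have "similar_mat G T" using w by (auto simp: similar_mat_def)
  then have "mat_trace G = mat_trace T" by (rule mat_trace_similar)
  also have "\<dots> = sum_list es"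
    using T by (simp add: mat_trace_def d[symmetric] diag_mat_def sum_list_distinct_conv_sum_set
        atLeast0LessThan)
  finally show "mat_trace G = sum_list es" .
  have "similar_mat (G ^\<^sub>m 2) (T ^\<^sub>m 2)"
    using similar_mat_wit_pow[OF w, of 2] by (auto simp: similar_mat_def)
  then have "similar_mat (G * G) (T * T)" using G T by (simp add: numeral_2_eq_2)
  then have "mat_trace (G * G) = mat_trace (T * T)" by (rule mat_trace_similar)
  also have "\<dots> = (\<Sum>i<n. \<Sum>j<n. T $$ (i, j) * T $$ (j, i))"
    using T by (simp add: mat_trace_def scalar_prod_def atLeast0LessThan)
  \<comment> \<open>Off the diagonal one of the mirrored entries of \<open>T\<close> lies below the
    diagonal and vanishes.\<close>
  also have "\<dots> = (\<Sum>i<n. \<Sum>j<n. if j = i then (T $$ (i, i))\<^sup>2 else 0)"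
  proof (intro sum.cong refl)
    fix i j assume "i \<in> {..<n}" "j \<in> {..<n}"
    then show "T $$ (i, j) * T $$ (j, i) = (if j = i then (T $$ (i, i))\<^sup>2 else 0)"
      using upper_triangularD[OF ut, of i j] upper_triangularD[OF ut, of j i] T
      by (cases i j rule: linorder_cases) (auto simp: power2_eq_square)
  qed
  also have "\<dots> = (\<Sum>a\<leftarrow>es. a\<^sup>2)"
    using T by (simp add: d[symmetric] diag_mat_def sum_list_distinct_conv_sum_set
        atLeast0LessThan o_def)
  finally show "mat_trace (G * G) = (\<Sum>a\<leftarrow>es. a\<^sup>2)" .
qed

section \<open>Adjoints, Gram entries and singular values\<close>

lemma mat_adjoint_carrier:
  "A \<in> carrier_mat m n \<Longrightarrow> mat_adjoint A \<in> carrier_mat n m"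
  by (auto simp: mat_adjoint_def)

lemma mat_adjoint_index:
  "A \<in> carrier_mat m n \<Longrightarrow> i < n \<Longrightarrow> j < m \<Longrightarrow> mat_adjoint A $$ (i, j) = conjugate (A $$ (j, i))"
  by (simp add: mat_adjoint_def mat_of_rows_def)

text \<open>The entries of \<open>B B\<^sup>*\<close>, for \<open>B\<close> with \<open>n\<close> columns.\<close>

definition gram :: "nat \<Rightarrow> 'a::conjugatable_field mat \<Rightarrow> nat \<Rightarrow> nat \<Rightarrow> 'a"
  where "gram n B j l = (\<Sum>k<n. B $$ (j, k) * conjugate (B $$ (l, k)))"

lemma gram_conjugate: "conjugate (gram n B j l) = gram n B l j"
  unfolding gram_def by (subst sum_conjugate) (simp_all add: conjugate_dist_mul mult.commute)

text \<open>Cyclicity of the trace leads from \<open>A\<^sup>* A\<close>, which defines the singular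
  values, to \<open>A A\<^sup>*\<close>, whose entries are the coefficients of the quadratic form.
  Since the latter is Hermitian, the trace of its square is a sum of squared moduli.\<close>

lemma mat_trace_adjoint_mult:
  fixes A :: "'a::conjugatable_field mat"
  assumes A: "A \<in> carrier_mat m n"
  shows "mat_trace (mat_adjoint A * A) = (\<Sum>j<m. gram n A j j)"
    and "mat_trace ((mat_adjoint A * A) * (mat_adjoint A * A)) =
      (\<Sum>j<m. \<Sum>l<m. gram n A j l * conjugate (gram n A j l))"
proof -
  note Ad = mat_adjoint_carrier[OF A]
  have AA: "A * mat_adjoint A \<in> carrier_mat m m" using A Ad by auto
  have idx: "(A * mat_adjoint A) $$ (j, l) = gram n A j l" if "j < m" "l < m" for j l
    using that A Ad
    by (simp add: gram_def scalar_prod_def atLeast0LessThan mat_adjoint_index[OF A])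
  have "mat_trace (mat_adjoint A * A) = mat_trace (A * mat_adjoint A)"
    by (rule mat_trace_mult_comm[OF Ad A])
  then show "mat_trace (mat_adjoint A * A) = (\<Sum>j<m. gram n A j j)"
    using AA A idx by (simp add: mat_trace_def del: index_mult_mat)
  have "mat_trace ((mat_adjoint A * A) * (mat_adjoint A * A)) =
      mat_trace (mat_adjoint A * (A * mat_adjoint A * A))"
    using A Ad by (metis assoc_mult_mat mult_carrier_mat)
  also have "\<dots> = mat_trace ((A * mat_adjoint A * A) * mat_adjoint A)"
    using A Ad by (intro mat_trace_mult_comm[of _ n m]) auto
  also have "(A * mat_adjoint A * A) * mat_adjoint A = (A * mat_adjoint A) * (A * mat_adjoint A)"
    using A Ad by (intro assoc_mult_mat[of _ m m _ n _ m]) auto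
  also have "mat_trace \<dots> = (\<Sum>j<m. \<Sum>l<m. gram n A j l * gram n A l j)"
  proof -
    have "((A * mat_adjoint A) * (A * mat_adjoint A)) $$ (j, j) =
       (\<Sum>l<m. (A * mat_adjoint A) $$ (j, l) * (A * mat_adjoint A) $$ (l, j))" if "j < m" for j
      using that AA by (subst index_mult_mat) (auto simp: scalar_prod_def atLeast0LessThan simp del: index_mult_mat)
    then show ?thesis
      using A Ad idx by (simp add: mat_trace_def del: index_mult_mat(1))
  qed
  finally show "mat_trace ((mat_adjoint A * A) * (mat_adjoint A * A)) =
      (\<Sum>j<m. \<Sum>l<m. gram n A j l * conjugate (gram n A j l))"
    by (simp add: gram_conjugate)
qed

text \<open>The singular values are the square roots of \<open>rs\<close>, so an even exponent
  \<open>2 * k\<close> turns their power sum into that of the \<open>k\<close>-th powers of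
  \<open>rs\<close>. The outer root is then undone.\<close>

lemma schatten_norm_of_eigenvalues:
  fixes A :: "'a::{conjugatable_field, real_normed_field} mat"
  assumes cp: "char_poly (mat_adjoint A * A) = (\<Prod>r\<leftarrow>rs. [:- of_real r, 1:])"
    and nonneg: "\<And>r. r \<in> set rs \<Longrightarrow> r \<ge> 0"
  shows "(schatten_norm 2 A)\<^sup>2 = sum_list rs" and "schatten_norm 4 A ^ 4 = (\<Sum>r\<leftarrow>rs. r\<^sup>2)"
proof -
  have "proots (\<Prod>r\<leftarrow>rs. [:- of_real r, 1:]) = mset (map (of_real :: real \<Rightarrow> 'a) rs)"
  proof (induction rs)
    case (Cons r rs)
    have "(\<Prod>r\<leftarrow>rs. [:- of_real r, 1 :: 'a:]) \<noteq> 0"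
      by (auto simp: prod_list_zero_iff)
    then show ?case using Cons by (simp add: proots_mult del: mult_pCons_left)
  qed simp
  then have sv: "singular_values A = mset (map sqrt rs)"
    unfolding singular_values_def cp using nonneg
    by (auto simp: multiset.map_comp o_def intro!: image_mset_cong)
  have pow: "sqrt r powr (real (2 * k)) = r ^ k" if "r \<ge> 0" "k > 0" for r k
  \<comment> \<open>Passing from \<open>powr\<close> to an ordinary power needs a positive base; at
    zero both sides are 0 because \<open>k > 0\<close>.\<close>
  proof (cases "r = 0")
    case False
    then have "sqrt r powr (real (2 * k)) = sqrt r ^ (2 * k)"
      using that by (intro powr_realpow) simp
    also have "\<dots> = r ^ k"
      using that by (simp only: power_mult real_sqrt_pow2)
    finally show ?thesis .
  qed (use that in simp)
  have p: "(\<Sum>s\<in>#singular_values A. s powr (real (2 * k))) = (\<Sum>r\<leftarrow>rs. r ^ k)" if "k > 0" for k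
  proof -
    have "(\<Sum>s\<in>#singular_values A. s powr (real (2 * k))) = (\<Sum>r\<leftarrow>rs. sqrt r powr (real (2 * k)))"
      unfolding sv mset_map multiset.map_comp o_def sum_mset_sum_list[symmetric] ..
    also have "\<dots> = (\<Sum>r\<leftarrow>rs. r ^ k)"
      using pow[OF nonneg that] by (metis (no_types, lifting) map_eq_conv)
    finally show ?thesis .
  qed
  have root: "(x powr (1 / (real (2 * k)))) ^ (2 * k) = x" if "x \<ge> 0" "k > 0" for x k
  proof (cases "x = 0")
    case False
    with that have "(x powr (1 / (real (2 * k)))) ^ (2 * k) = (x powr (1 / (real (2 * k)))) powr (real (2 * k))"
      by (intro powr_realpow[symmetric]) simp
    also have "\<dots> = x" 
      using that False by (simp only: powr_powr) simp
    finally show ?thesis .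
  qed (use that in simp)
  have nn: "sum_list rs \<ge> 0" "(\<Sum>r\<leftarrow>rs. r\<^sup>2) \<ge> 0"
    using nonneg by (auto intro!: sum_list_nonneg)
  show "(schatten_norm 2 A)\<^sup>2 = sum_list rs"
    using p[of 1] root[OF nn(1), of 1] by (simp add: schatten_norm_def)
  show "schatten_norm 4 A ^ 4 = (\<Sum>r\<leftarrow>rs. r\<^sup>2)"
    using p[of 2] root[OF nn(2), of 2] by (simp add: schatten_norm_def)
qed

text \<open>The polynomial splits over the complex numbers. If \<open>v\<close> is an eigenvector
  for a root \<open>a\<close>, then \<open>a\<close> times the squared norm of \<open>v\<close> is
  the squared norm of \<open>A v\<close>, so \<open>a\<close> is real and nonnegative.\<close>

lemma char_poly_adjoint_mult_complex:
  fixes A :: "complex mat"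
  assumes A: "A \<in> carrier_mat m n"
  obtains rs where "char_poly (mat_adjoint A * A) = (\<Prod>r\<leftarrow>rs. [:- of_real r, 1:])"
    and "\<And>r. r \<in> set rs \<Longrightarrow> r \<ge> 0"
proof -
  let ?G = "mat_adjoint A * A"
  note Ad = mat_adjoint_carrier[OF A]
  have G: "?G \<in> carrier_mat n n" using A Ad by auto
  obtain as where as: "char_poly ?G = (\<Prod>a\<leftarrow>as. [:- a, 1:])"
    using char_poly_factorized[OF G] by blast
  have ev: "a = of_real (Re a) \<and> Re a \<ge> 0" if "a \<in> set as" for a
  proof -
    have "poly (char_poly ?G) a = 0"
      using that by (auto simp: as poly_prod_list prod_list_zero_iff image_iff)
    then obtain v where v: "v \<in> carrier_vec n" "v \<noteq> 0\<^sub>v n" and Gv: "?G *\<^sub>v v = a \<cdot>\<^sub>v v"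
      using eigenvalue_root_char_poly[OF G, of a] G by (auto simp: eigenvalue_def eigenvector_def)
    define w where "w = A *\<^sub>v v"
    have w: "w \<in> carrier_vec m" using A v by (simp add: w_def)
    have wi: "vec_index w j = (\<Sum>i<n. A $$ (j, i) * vec_index v i)" if "j < m" for j
      using that A v by (simp add: w_def scalar_prod_def atLeast0LessThan)
    have Gw: "?G *\<^sub>v v = mat_adjoint A *\<^sub>v w"
      using A Ad v by (simp add: w_def)
    have "a * (v \<bullet>c v) = (mat_adjoint A *\<^sub>v w) \<bullet>c v"
      using v unfolding Gw[symmetric] Gv by simp
    also have "\<dots> = (\<Sum>i<n. (\<Sum>j<m. conjugate (A $$ (j, i)) * vec_index w j) * conjugate (vec_index v i))"
      using A Ad v w by (simp add: scalar_prod_def atLeast0LessThan mat_adjoint_index[OF A] del: conjugate_complex_def)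
    also have "\<dots> = (\<Sum>j<m. vec_index w j * conjugate (\<Sum>i<n. A $$ (j, i) * vec_index v i))"
      unfolding sum_distrib_right
      by (subst sum.swap) (simp add: sum_conjugate sum_distrib_left mult_ac del: conjugate_complex_def add: conjugate_dist_mul)
    also have "\<dots> = w \<bullet>c w"
      using w by (simp add: wi scalar_prod_def atLeast0LessThan del: conjugate_complex_def)
    finally have eq: "a * (v \<bullet>c v) = w \<bullet>c w" .
    \<comment> \<open>Comparison of complex numbers includes equality of imaginary parts, so these
      two facts also say that both inner products are real.\<close>
    have "v \<bullet>c v > 0" using v by simp
    moreover have "w \<bullet>c w \<ge> 0" by (rule conjugate_square_ge_0_vec)
    ultimately have "Im (v \<bullet>c v) = 0" "Re (v \<bullet>c v) > 0" "Im (w \<bullet>c w) = 0" "Re (w \<bullet>c w) \<ge> 0"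
      by (auto simp: less_complex_def less_eq_complex_def)
    with arg_cong[OF eq, of Re] arg_cong[OF eq, of Im] show ?thesis
      by (auto simp: complex_eq_iff) (metis zero_le_mult_iff not_less)
  qed
  show thesis
  proof
    show "char_poly ?G = (\<Prod>r\<leftarrow>map Re as. [:- of_real r, 1:])"
      unfolding as using ev by (auto simp: o_def intro!: arg_cong[of _ _ prod_list] map_cong)
    show "\<And>r. r \<in> set (map Re as) \<Longrightarrow> r \<ge> 0" using ev by auto
  qed
qed

text \<open>
  Schur triangularisation needs a split characteristic polynomial, which over the reals is inherited
  from the complex case because the complex roots are real.
\<close>

lemma char_poly_adjoint_mult_real:
  fixes A :: "real mat"
  assumes A: "A \<in> carrier_mat m n"
  obtains rs where "char_poly (mat_adjoint A * A) = (\<Prod>r\<leftarrow>rs. [:- of_real r, 1:])"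
    and "\<And>r. r \<in> set rs \<Longrightarrow> r \<ge> 0"
proof -
  interpret hp: map_poly_inj_comm_ring_hom complex_of_real ..
  let ?G = "mat_adjoint A * A" and ?c = "map_mat complex_of_real"
  note Ad = mat_adjoint_carrier[OF A]
  have G: "?G \<in> carrier_mat n n" using A Ad by auto
  have cA: "?c A \<in> carrier_mat m n" using A by simp
  have "?c (mat_adjoint A) = mat_adjoint (?c A)"
    using mat_adjoint_carrier[OF cA] Ad A
    by (intro eq_matI) (auto simp: mat_adjoint_index[OF A] mat_adjoint_index[OF cA])
  then have hG: "?c ?G = mat_adjoint (?c A) * ?c A"
    by (simp only: of_real_hom.mat_hom_mult[OF Ad A])
  obtain rs where rs: "char_poly (mat_adjoint (?c A) * ?c A) = (\<Prod>r\<leftarrow>rs. [:- of_real r, 1:])"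
    and nn: "\<And>r. r \<in> set rs \<Longrightarrow> r \<ge> 0"
    using char_poly_adjoint_mult_complex[OF cA] by metis
  have "map_poly complex_of_real (char_poly ?G) = (\<Prod>r\<leftarrow>rs. [:- of_real r, 1:])"
    by (simp only: rs hG of_real_hom.char_poly_hom[OF G, symmetric])
  also have "\<dots> = map_poly complex_of_real (\<Prod>r\<leftarrow>rs. [:- r, 1:])"
    by (simp add: hp.hom_prod_list o_def)
  \<comment> \<open>Embedding real polynomials into complex ones is injective, so the factorisation
    descends to the reals.\<close>
  finally have "char_poly ?G = (\<Prod>r\<leftarrow>rs. [:- of_real r, 1:])" by simp
  then show thesis using nn by (rule that)
qed

text \<open>The argument common to both fields, with the factorisation of the characteristic
  polynomial left as a hypothesis. The trace identities hold in the field itself; injectivity of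
  \<open>of_real\<close> brings them back to real numbers.\<close>

lemma schatten_norm_gram:
  fixes A :: "'a::{conjugatable_ordered_field, real_normed_field} mat"
  assumes A: "A \<in> carrier_mat m n"
    and conj: "\<And>z :: 'a. z * conjugate z = of_real ((norm z)\<^sup>2)"
    and cp: "char_poly (mat_adjoint A * A) = (\<Prod>r\<leftarrow>rs. [:- of_real r, 1:])"
    and nonneg: "\<And>r. r \<in> set rs \<Longrightarrow> r \<ge> 0"
  shows "of_real ((schatten_norm 2 A)\<^sup>2) = (\<Sum>j<m. gram n A j j)"
    and "(schatten_norm 2 A)\<^sup>2 = (\<Sum>j<m. \<Sum>k<n. (norm (A $$ (j, k)))\<^sup>2)"
    and "schatten_norm 4 A ^ 4 = (\<Sum>j<m. \<Sum>l<m. (norm (gram n A j l))\<^sup>2)"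
proof -
  let ?G = "mat_adjoint A * A"
  have G: "?G \<in> carrier_mat n n" using A mat_adjoint_carrier[OF A] by auto
  have cp': "char_poly ?G = (\<Prod>a\<leftarrow>map of_real rs. [:- a, 1:])"
    using cp by (simp add: o_def)
  have sum: "(of_real (\<Sum>r\<leftarrow>rs. f r) :: 'a) = (\<Sum>r\<leftarrow>rs. of_real (f r))" for f rs
    by (induction rs) auto
  show *: "of_real ((schatten_norm 2 A)\<^sup>2) = (\<Sum>j<m. gram n A j j)"
    using trace_eq_sum_eigenvalues(1)[OF G cp'] mat_trace_adjoint_mult(1)[OF A]
      sum[of "\<lambda>r. r" rs] schatten_norm_of_eigenvalues(1)[OF cp nonneg] by simp
  then have "(of_real ((schatten_norm 2 A)\<^sup>2) :: 'a) = of_real (\<Sum>j<m. \<Sum>k<n. (norm (A $$ (j, k)))\<^sup>2)"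
    by (simp add: gram_def conj)
  then show "(schatten_norm 2 A)\<^sup>2 = (\<Sum>j<m. \<Sum>k<n. (norm (A $$ (j, k)))\<^sup>2)"
    unfolding of_real_eq_iff .
  have "(of_real (schatten_norm 4 A ^ 4) :: 'a) = of_real (\<Sum>j<m. \<Sum>l<m. (norm (gram n A j l))\<^sup>2)"
    using trace_eq_sum_eigenvalues(2)[OF G cp'] mat_trace_adjoint_mult(2)[OF A]
      sum[of "\<lambda>r. r\<^sup>2" rs] schatten_norm_of_eigenvalues(2)[OF cp nonneg]
    by (simp add: conj o_def)
  then show "schatten_norm 4 A ^ 4 = (\<Sum>j<m. \<Sum>l<m. (norm (gram n A j l))\<^sup>2)"
    unfolding of_real_eq_iff .
qed

text \<open>The two formulas for the 2-norm serve different matrices: the entrywise one expands the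
  norm of the random product, the Gram one recognises the mean as the norm of the fixed
  difference.\<close>

lemma
  fixes A :: "real mat"
  assumes A: "A \<in> carrier_mat m n"
  shows schatten_norm_2_real: "(schatten_norm 2 A)\<^sup>2 = (\<Sum>j<m. \<Sum>k<n. (A $$ (j, k))\<^sup>2)"
    and schatten_norm_2_gram_real: "(schatten_norm 2 A)\<^sup>2 = (\<Sum>j<m. gram n A j j)"
    and schatten_norm_4_real: "schatten_norm 4 A ^ 4 = (\<Sum>j<m. \<Sum>l<m. (gram n A j l)\<^sup>2)"
proof -
  obtain rs where rs: "char_poly (mat_adjoint A * A) = (\<Prod>r\<leftarrow>rs. [:- of_real r, 1:])"
    and nn: "\<And>r. r \<in> set rs \<Longrightarrow> r \<ge> 0"
    using char_poly_adjoint_mult_real[OF A] by metis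
  have c: "z * conjugate z = of_real ((norm z)\<^sup>2)" for z :: real
    by (simp add: power2_eq_square)
  from schatten_norm_gram[OF A c rs nn]
  show "(schatten_norm 2 A)\<^sup>2 = (\<Sum>j<m. \<Sum>k<n. (A $$ (j, k))\<^sup>2)"
    "(schatten_norm 2 A)\<^sup>2 = (\<Sum>j<m. gram n A j j)"
    "schatten_norm 4 A ^ 4 = (\<Sum>j<m. \<Sum>l<m. (gram n A j l)\<^sup>2)"
    by simp_all
qed

lemma
  fixes A :: "complex mat"
  assumes A: "A \<in> carrier_mat m n"
  shows schatten_norm_2_complex: "(schatten_norm 2 A)\<^sup>2 = (\<Sum>j<m. \<Sum>k<n. (cmod (A $$ (j, k)))\<^sup>2)"
    and schatten_norm_2_gram_complex: "(schatten_norm 2 A)\<^sup>2 = (\<Sum>j<m. Re (gram n A j j))"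
    and schatten_norm_4_complex: "schatten_norm 4 A ^ 4 = (\<Sum>j<m. \<Sum>l<m. (cmod (gram n A j l))\<^sup>2)"
proof -
  obtain rs where rs: "char_poly (mat_adjoint A * A) = (\<Prod>r\<leftarrow>rs. [:- of_real r, 1:])"
    and nn: "\<And>r. r \<in> set rs \<Longrightarrow> r \<ge> 0"
    using char_poly_adjoint_mult_complex[OF A] by metis
  have c: "z * conjugate z = of_real ((norm z)\<^sup>2)" for z :: complex
    by (simp only: conjugate_complex_def complex_norm_square)
  note * = schatten_norm_gram[OF A c rs nn]
  show "(schatten_norm 2 A)\<^sup>2 = (\<Sum>j<m. \<Sum>k<n. (cmod (A $$ (j, k)))\<^sup>2)"
    "schatten_norm 4 A ^ 4 = (\<Sum>j<m. \<Sum>l<m. (cmod (gram n A j l))\<^sup>2)"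
    using * by simp_all
  show "(schatten_norm 2 A)\<^sup>2 = (\<Sum>j<m. Re (gram n A j j))"
    using arg_cong[OF *(1), of Re] by simp
qed

section \<open>The error estimator\<close>

lemma sum_row_gram:
  fixes z :: "nat \<Rightarrow> 'a::conjugatable_field"
  shows "(\<Sum>k<n. (\<Sum>j<m. z j * B $$ (j, k)) * conjugate (\<Sum>j<m. z j * B $$ (j, k))) =
    (\<Sum>a<m. \<Sum>b<m. gram n B a b * (z a * conjugate (z b)))"
proof -
  have "(\<Sum>k<n. (\<Sum>j<m. z j * B $$ (j, k)) * conjugate (\<Sum>j<m. z j * B $$ (j, k))) =
    (\<Sum>k<n. \<Sum>a<m. \<Sum>b<m. B $$ (a, k) * conjugate (B $$ (b, k)) * (z a * conjugate (z b)))"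
    by (simp add: sum_conjugate conjugate_dist_mul sum_product mult_ac)
  also have "\<dots> = (\<Sum>a<m. \<Sum>k<n. \<Sum>b<m. B $$ (a, k) * conjugate (B $$ (b, k)) * (z a * conjugate (z b)))"
    by (rule sum.swap)
  also have "\<dots> = (\<Sum>a<m. \<Sum>b<m. gram n B a b * (z a * conjugate (z b)))"
    unfolding gram_def sum_distrib_right by (intro sum.cong refl sum.swap)
  finally show ?thesis .
qed

lemma mult_mat_index:
  assumes "X \<in> carrier_mat q m" "B \<in> carrier_mat m n" "i < q" "k < n"
  shows "(X * B) $$ (i, k) = (\<Sum>j<m. X $$ (i, j) * B $$ (j, k))"
  using assms by (simp add: scalar_prod_def atLeast0LessThan)

lemma schatten_norm_2_mult_real:
  fixes X B :: "real mat"
  assumes X: "X \<in> carrier_mat q m" and B: "B \<in> carrier_mat m n"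
  shows "(schatten_norm 2 (X * B))\<^sup>2 =
    (\<Sum>i<q. \<Sum>a<m. \<Sum>b<m. gram n B a b * (X $$ (i, a) * X $$ (i, b)))"
proof -
  have "(schatten_norm 2 (X * B))\<^sup>2 = (\<Sum>i<q. \<Sum>k<n. ((X * B) $$ (i, k))\<^sup>2)"
    by (rule schatten_norm_2_real[OF mult_carrier_mat[OF X B]])
  also have "\<dots> = (\<Sum>i<q. \<Sum>a<m. \<Sum>b<m. gram n B a b * (X $$ (i, a) * X $$ (i, b)))"
  proof (rule sum.cong[OF refl])
    fix i assume "i \<in> {..<q}"
    then show "(\<Sum>k<n. ((X * B) $$ (i, k))\<^sup>2) =
        (\<Sum>a<m. \<Sum>b<m. gram n B a b * (X $$ (i, a) * X $$ (i, b)))"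
      using sum_row_gram[where z = "\<lambda>j. X $$ (i, j)" and B = B and m = m and n = n]
      by (simp add: mult_mat_index[OF X B] power2_eq_square del: index_mult_mat)
  qed
  finally show ?thesis .
qed

lemma sum_times_bool:
  fixes f :: "nat \<times> bool \<Rightarrow> nat \<times> bool \<Rightarrow> real"
  shows "(\<Sum>x\<in>{..<m} \<times> UNIV. \<Sum>y\<in>{..<m} \<times> UNIV. f x y) =
    (\<Sum>a<m. \<Sum>b<m. f (a, False) (b, False) + f (a, False) (b, True)
      + f (a, True) (b, False) + f (a, True) (b, True))"
  by (simp add: sum.cartesian_product' UNIV_bool sum.distrib)

text \<open>
  The real symmetric matrix of the Hermitian form \<open>z H z\<^sup>*\<close> in the coordinates \<open>Re z\<close>, \<open>Im z\<close>; the
  Boolean component of an index is true for the imaginary part.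
\<close>

definition realified_gram :: "nat \<Rightarrow> complex mat \<Rightarrow> nat \<times> bool \<Rightarrow> nat \<times> bool \<Rightarrow> real"
  where "realified_gram n B = (\<lambda>(a, c) (b, d).
    if c = d then Re (gram n B a b) else if c then - Im (gram n B a b) else Im (gram n B a b))"

text \<open>For a Hermitian matrix the real part is symmetric and the imaginary part antisymmetric.
  The latter sign is cancelled by the sign convention, which flips when the Boolean components trade
  places.\<close>

lemma realified_gram_sym: "realified_gram n B x y = realified_gram n B y x"
  using gram_conjugate[of n B "fst x" "fst y"]
  by (cases x; cases y) (auto simp: realified_gram_def complex_eq_iff)

lemma schatten_norm_2_mult_complex:
  fixes X B :: "complex mat"
  assumes X: "X \<in> carrier_mat q m" and B: "B \<in> carrier_mat m n"
  defines "g \<equiv> \<lambda>(i, j, c). (if c then Im else Re) (X $$ (i, j))"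
  shows "(schatten_norm 2 (X * B))\<^sup>2 =
    (\<Sum>i<q. \<Sum>x\<in>{..<m} \<times> UNIV. \<Sum>y\<in>{..<m} \<times> UNIV. realified_gram n B x y * (g (i, x) * g (i, y)))"
proof -
  have "(schatten_norm 2 (X * B))\<^sup>2 = (\<Sum>i<q. \<Sum>k<n. (cmod ((X * B) $$ (i, k)))\<^sup>2)"
    by (rule schatten_norm_2_complex[OF mult_carrier_mat[OF X B]])
  also have "\<dots> = (\<Sum>i<q. \<Sum>x\<in>{..<m} \<times> UNIV. \<Sum>y\<in>{..<m} \<times> UNIV.
      realified_gram n B x y * (g (i, x) * g (i, y)))"
  proof (intro sum.cong refl)
    fix i assume i: "i \<in> {..<q}"
    \<comment> \<open>The squared norm of a row is first written as a Hermitian form over the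
      complex numbers; since its value is real, taking the real part loses nothing.\<close>
    have "complex_of_real (\<Sum>k<n. (cmod ((X * B) $$ (i, k)))\<^sup>2) =
        (\<Sum>k<n. (X * B) $$ (i, k) * conjugate ((X * B) $$ (i, k)))"
      by (simp only: of_real_sum conjugate_complex_def complex_norm_square)
    also have "\<dots> = (\<Sum>a<m. \<Sum>b<m. gram n B a b * (X $$ (i, a) * conjugate (X $$ (i, b))))"
      using i sum_row_gram[where z = "\<lambda>j. X $$ (i, j)" and B = B and m = m and n = n]
      by (simp add: mult_mat_index[OF X B] del: index_mult_mat)
    finally have "(\<Sum>k<n. (cmod ((X * B) $$ (i, k)))\<^sup>2) =
        Re (\<Sum>a<m. \<Sum>b<m. gram n B a b * (X $$ (i, a) * conjugate (X $$ (i, b))))"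
      by (metis Re_complex_of_real)
    also have "\<dots> = (\<Sum>x\<in>{..<m} \<times> UNIV. \<Sum>y\<in>{..<m} \<times> UNIV.
        realified_gram n B x y * (g (i, x) * g (i, y)))"
      unfolding sum_times_bool Re_sum
      \<comment> \<open>For \<open>z = x + i y\<close> and \<open>H\<close> the Gram matrix, each
        term is \<open>Re H_ab (x_a x_b + y_a y_b) - Im H_ab (y_a x_b - x_a y_b)\<close>, which
        accounts for the signs in \<open>realified_gram\<close>.\<close>
      by (intro sum.cong refl) (simp add: realified_gram_def g_def algebra_simps)
    finally show "(\<Sum>k<n. (cmod ((X * B) $$ (i, k)))\<^sup>2) = (\<Sum>x\<in>{..<m} \<times> UNIV. \<Sum>y\<in>{..<m} \<times> UNIV.
        realified_gram n B x y * (g (i, x) * g (i, y)))" .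
  qed
  finally show ?thesis .
qed

section \<open>Mean and variance of the estimator over both fields\<close>

context prob_space
begin

lemma err_sq_real_has_mean_variance:
  assumes "q \<ge> 1" and \<Theta>: "std_normal_mat q m \<Theta>"
    and A: "A \<in> carrier_mat m n" and Aout: "Aout \<in> carrier_mat m n"
  shows "has_mean_variance (\<lambda>\<omega>. err_sq 1 q (\<Theta> \<omega>) A Aout)
    ((schatten_norm 2 (A - Aout))\<^sup>2) (2 / (1 * real q) * schatten_norm 4 (A - Aout) ^ 4)"
proof -
  let ?B = "A - Aout"
  have B: "?B \<in> carrier_mat m n" using A Aout by auto
  have sym: "gram n ?B a b = gram n ?B b a" for a b
    using gram_conjugate[of n ?B a b] by simp
  \<comment> \<open>With \<open>c = 1 / q\<close> the block factors \<open>c * q\<close> and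
    \<open>2 * c\<^sup>2 * q\<close> become 1 and \<open>2 / q\<close>.\<close>
  have mean: "1 / real q * real q * t = t" and var: "2 * (1 / real q)\<^sup>2 * real q * t = 2 / (1 * real q) * t"
    for t :: real
    using \<open>q \<ge> 1\<close> by (simp_all add: power2_eq_square)
  have "has_mean_variance
    (\<lambda>\<omega>. 1 / real q * (\<Sum>i<q. \<Sum>a<m. \<Sum>b<m. gram n ?B a b * (\<Theta> \<omega> $$ (i, a) * \<Theta> \<omega> $$ (i, b))))
    ((schatten_norm 2 ?B)\<^sup>2) (2 / (1 * real q) * schatten_norm 4 ?B ^ 4)"
    using block_quadratic_form_has_mean_variance[where c = "1 / real q" and T = "gram n ?B",
      OF finite_lessThan std_normal_mat_moments[OF \<Theta>] sym]
    by (simp only: mean var schatten_norm_2_gram_real[OF B] schatten_norm_4_real[OF B] prod.case)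
  then show ?thesis
    using \<Theta> by (subst has_mean_variance_cong)
      (auto simp: err_sq_def schatten_norm_2_mult_real[OF _ B] std_normal_mat_def)
qed

text \<open>Passing to real coordinates doubles both the trace and the squared Frobenius norm of the
  Gram matrix. With \<open>c = 1 / (2 * q)\<close> the doubled mean is restored, while the variance
  factor becomes \<open>4 * c\<^sup>2 * q = 1 / q\<close>.\<close>

lemma err_sq_complex_has_mean_variance:
  assumes "q \<ge> 1" and \<Theta>: "std_normal_mat_complex q m \<Theta>"
    and A: "A \<in> carrier_mat m n" and Aout: "Aout \<in> carrier_mat m n"
  shows "has_mean_variance (\<lambda>\<omega>. err_sq 2 q (\<Theta> \<omega>) A Aout)
    ((schatten_norm 2 (A - Aout))\<^sup>2) (2 / (2 * real q) * schatten_norm 4 (A - Aout) ^ 4)"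
proof -
  let ?B = "A - Aout" and ?J = "{..<m} \<times> (UNIV :: bool set)"
  let ?g = "\<lambda>(i, j, c) \<omega>. (if c then Im else Re) (\<Theta> \<omega> $$ (i, j))"
  have B: "?B \<in> carrier_mat m n" using A Aout by auto
  have tr: "(\<Sum>x\<in>?J. realified_gram n ?B x x) = 2 * (schatten_norm 2 ?B)\<^sup>2"
    by (simp add: sum.cartesian_product' UNIV_bool realified_gram_def schatten_norm_2_gram_complex[OF B]
        sum_distrib_left)
  \<comment> \<open>The four entries replacing a Gram entry are its real part twice and its
    imaginary part twice up to sign, so their squares add up to twice its squared modulus.\<close>
  have fro: "(\<Sum>x\<in>?J. \<Sum>y\<in>?J. (realified_gram n ?B x y)\<^sup>2) = 2 * schatten_norm 4 ?B ^ 4"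
    unfolding sum_times_bool schatten_norm_4_complex[OF B] sum_distrib_left
    by (intro sum.cong refl) (simp add: realified_gram_def cmod_power2)
  have mean: "1 / (2 * real q) * real q * (2 * t) = t"
    and var: "2 * (1 / (2 * real q))\<^sup>2 * real q * (2 * t) = 2 / (2 * real q) * t" for t :: real
    using \<open>q \<ge> 1\<close> by (simp_all add: power2_eq_square)
  have "has_mean_variance
    (\<lambda>\<omega>. 1 / (2 * real q) *
      (\<Sum>i<q. \<Sum>x\<in>?J. \<Sum>y\<in>?J. realified_gram n ?B x y * (?g (i, x) \<omega> * ?g (i, y) \<omega>)))
    ((schatten_norm 2 ?B)\<^sup>2) (2 / (2 * real q) * schatten_norm 4 ?B ^ 4)"
    using block_quadratic_form_has_mean_variance[where c = "1 / (2 * real q)" and J = ?J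
        and T = "realified_gram n ?B",
      OF finite_cartesian_product[OF finite_lessThan finite_class.finite_UNIV]
        std_normal_mat_complex_moments[OF \<Theta>] realified_gram_sym]
    by (simp only: tr fro mean var prod.case)
  then show ?thesis
    using \<Theta> by (subst has_mean_variance_cong)
      (auto simp: err_sq_def schatten_norm_2_mult_complex[OF _ B] std_normal_mat_complex_def
        case_prod_unfold)
qed

end

theorem mainTheorem3:
  fixes M :: "'w measure" and m n q :: nat
  assumes "prob_space M" and "q \<ge> 1"
  shows
    "(\<forall>(\<Theta> :: 'w \<Rightarrow> real mat) A Aout.
        prob_space.std_normal_mat M q m \<Theta> \<longrightarrow> A \<in> carrier_mat m n \<longrightarrow> Aout \<in> carrier_mat m n \<longrightarrow>
        prob_space.has_mean_variance M (\<lambda>\<omega>. err_sq 1 q (\<Theta> \<omega>) A Aout)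
          ((schatten_norm 2 (A - Aout))\<^sup>2)
          (2 / (1 * real q) * schatten_norm 4 (A - Aout) ^ 4)) \<and>
     (\<forall>(\<Theta> :: 'w \<Rightarrow> complex mat) A Aout.
        prob_space.std_normal_mat_complex M q m \<Theta> \<longrightarrow> A \<in> carrier_mat m n \<longrightarrow> Aout \<in> carrier_mat m n \<longrightarrow>
        prob_space.has_mean_variance M (\<lambda>\<omega>. err_sq 2 q (\<Theta> \<omega>) A Aout)
          ((schatten_norm 2 (A - Aout))\<^sup>2)
          (2 / (2 * real q) * schatten_norm 4 (A - Aout) ^ 4))"
  using prob_space.err_sq_real_has_mean_variance[OF assms]
    prob_space.err_sq_complex_has_mean_variance[OF assms] by blast

end
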